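(* Let $r\in\mathbb{N}$, $t\in\mathbb{N}_0$, and let $a_j,b_j\in\mathbb{N}_0$ and integers $c_j\ge3$ for all $j\ge1$. (i) If $a_1\ge1$ and $\mathbf{s}=(\{2\}^{a_1},1,\{2\}^{b_1},c_1,\dots,\{2\}^{a_r},1,\{2\}^{b_r},c_r,\{2\}^t)$, then \[\zeta^\star(\mathbf{s})=-\sum_{\mathbf{p}\in\Pi(2a_1+1,\overline{2b_1+2},\{1\}^{c_1-3},\overline{2a_2+2},\overline{2b_2+2},\{1\}^{c_2-3},\dots,\overline{2a_r+2},\overline{2b_r+2},\{1\}^{c_r-3},2t+1)}2^{\ell(\mathbf{p})}\zeta(\mathbf{p}).\] (ii) If $\mathbf{s}=(\{2\}^{b_1},c_1,\{2\}^{a_1},1,\dots,\{2\}^{b_r},c_r,\{2\}^{a_r},1,\{2\}^{b_{r+1}},c_{r+1},\{2\}^t)$, then \[\zeta^\star(\mathbf{s})=-\sum_{\mathbf{p}\in\Pi(\overline{2b_1+2},\{1\}^{c_1-3},\overline{2a_1+2},\dots,\overline{2b_r+2},\{1\}^{c_r-3},\overline{2a_r+2},\overline{2b_{r+1}+2},\{1\}^{c_{r+1}-3},2t+1)}2^{\ell(\mathbf{p})}\zeta(\mathbf{p}).\]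
   Context: $\mathbb{N}=\{1,2,\dots\}$, $\mathbb{N}_0=\mathbb{N}\cup\{0\}$; for a positive integer $m$, $\overline{m}$ denotes $-m$. $\{x\}^a$ denotes $a$ consecutive copies of $x$. For $\mathbf{s}=(s_1,\dots,s_\ell)$ with nonzero integer entries, $H_n(\mathbf{s})=\sum_{n\ge k_1>\cdots>k_\ell\ge1}\prod_{i=1}^\ell \frac{\operatorname{sgn}(s_i)^{k_i}}{k_i^{|s_i|}}$, $H^\star_n(\mathbf{s})$ is the same with $\ge$ in place of $>$, and when $s_1\ne1$, $\zeta(\mathbf{s})=\lim_{n\to\infty}H_n(\mathbf{s})$, $\zeta^\star(\mathbf{s})=\lim_{n\to\infty}H^\star_n(\mathbf{s})$. For nonzero integers $a,b$, $a\oplus b=\operatorname{sgn}(a)b+\operatorname{sgn}(b)a$. For a sequence $(s_1,\dots,s_m)$ of nonzero integers, $\Pi(s_1,\dots,s_m)$ is the set of the $2^{m-1}$ indices $s_1\circ\cdots\circ s_m$ where each $\circ$ is independently "," or $\oplus$ (entries joined by $\oplus$ merge into one component); $\ell(\mathbf{p})$ is the number of components. *)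

theory Defs
  imports Complex_Main
begin

(* An index is a list of nonzero integers; a negative entry -m stands for "m bar".
   In both sums below the list ks holds the summation variables k_1, ..., k_l. *)

definition mhs_term :: "int list \<Rightarrow> nat list \<Rightarrow> real" where
  "mhs_term s ks =
     (\<Prod>i<length s. of_int (sgn (s ! i)) ^ (ks ! i) / real (ks ! i) ^ nat \<bar>s ! i\<bar>)"

definition mhs :: "nat \<Rightarrow> int list \<Rightarrow> real" where
  "mhs n s =
     (\<Sum>ks\<in>{ks. length ks = length s \<and> set ks \<subseteq> {1..n} \<and> sorted_wrt (>) ks}. mhs_term s ks)"

definition mhs_star :: "nat \<Rightarrow> int list \<Rightarrow> real" where
  "mhs_star n s =
     (\<Sum>ks\<in>{ks. length ks = length s \<and> set ks \<subseteq> {1..n} \<and> sorted_wrt (\<ge>) ks}. mhs_term s ks)"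

(* Meaningful when the first entry is not 1, which is when the limits exist. *)

definition mzv :: "int list \<Rightarrow> real" where
  "mzv s = lim (\<lambda>n. mhs n s)"

definition mzv_star :: "int list \<Rightarrow> real" where
  "mzv_star s = lim (\<lambda>n. mhs_star n s)"

definition merge :: "int \<Rightarrow> int \<Rightarrow> int"  (infixl "\<oplus>" 65) where
  "a \<oplus> b = sgn a * b + sgn b * a"

(* All indices s_1 o ... o s_m with each o either a comma or \<oplus>. The first connective is
   resolved first; bracketing is immaterial, as \<oplus> is associative on nonzero integers. *)

fun merges :: "int list \<Rightarrow> int list set" where
  "merges [] = {}"
| "merges [s] = {[s]}"
| "merges (s # u # us) = (#) s ` merges (u # us) \<union> merges ((s \<oplus> u) # us)"

end

theory Submission
  imports Defs "HOL-Analysis.Uniform_Limit" "HOL-Analysis.Summation_Tests"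
begin

text \<open>Every star sum has a unique expansion \<open>H\<^sup>\<star>\<^sub>n(s) = (\<Sum>k=1..n. w\<^sub>n(k) * A\<^sub>s(k))\<close> with the weights
  \<open>w\<^sub>n(k) = (n choose k) / (n + k choose k)\<close>. Since \<open>w\<^sub>n(k) - w\<^sub>n\<^sub>-\<^sub>1(k) = (k\<^sup>2 / n\<^sup>2) * w\<^sub>n(k)\<close>,
  prepending a 2 to \<open>s\<close> divides \<open>A\<^sub>s\<close> by \<open>k\<^sup>2\<close>. Multiplication of the sum by \<open>n\<close> corresponds to \<open>k * P\<close>
  with \<open>(P A)(k) = A(k) + 2 * (\<Sum>l<k. A(l))\<close>, whose inverse is the conjugate of \<open>P\<close> by the sign
  \<open>(-1)\<^sup>k\<close>; this settles the entries 1 and \<open>c\<close> as well. The factors 2 in \<open>P\<close> account for \<open>2\<^sup>\<ell>\<^sup>(\<^sup>p\<^sup>)\<close>, and its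
  diagonal term for the merged entries. Finally \<open>w\<^sub>n(k) \<rightarrow> 1\<close>, and Tannery's theorem yields the limit.\<close>

section \<open>Recursions for harmonic sums\<close>

definition zterm :: "int \<Rightarrow> nat \<Rightarrow> real" where
  "zterm x k = of_int (sgn x) ^ k / real k ^ nat \<bar>x\<bar>"

lemma mhs_term_Cons: "mhs_term (x # s) (k # ks) = zterm x k * mhs_term s ks"
  by (simp add: mhs_term_def zterm_def prod.lessThan_Suc_shift del: prod.lessThan_Suc)

lemma finite_index: "finite {ks. length ks = m \<and> set ks \<subseteq> {1..n::nat} \<and> Q ks}"
  by (rule finite_subset[OF _ finite_lists_length_eq[of "{1..n}" m]]) auto

lemma mhs_Nil [simp]: "mhs n [] = 1"
proof -
  have "{ks. length ks = length ([] :: int list) \<and> set ks \<subseteq> {1..n} \<and> sorted_wrt (>) ks} = {[]}" by auto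
  then show ?thesis by (simp add: mhs_def mhs_term_def)
qed

lemma mhs_star_Nil [simp]: "mhs_star n [] = 1"
proof -
  have "{ks. length ks = length ([] :: int list) \<and> set ks \<subseteq> {1..n} \<and> sorted_wrt (\<ge>) ks} = {[]}" by auto
  then show ?thesis by (simp add: mhs_star_def mhs_term_def)
qed

lemma mhs_Cons: "mhs n (x # s) = (\<Sum>k=1..n. zterm x k * mhs (k - 1) s)"
proof -
  let ?I = "\<lambda>n m. {ks. length ks = m \<and> set ks \<subseteq> {1..n::nat} \<and> sorted_wrt (>) ks}"
  have eq: "?I n (length (x # s)) = (\<lambda>(k, ks). k # ks) ` (SIGMA k:{1..n}. ?I (k - 1) (length s))" (is "?L = ?R")
  proof (intro equalityI subsetI)
    fix ks assume ks: "ks \<in> ?L"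
    then obtain k ks' where k: "ks = k # ks'" by (cases ks) auto
    with ks show "ks \<in> ?R" by (force simp: image_iff)
  next
    fix ks assume "ks \<in> ?R" then show "ks \<in> ?L" by fastforce
  qed
  have "mhs n (x # s) = (\<Sum>(k, ks)\<in>(SIGMA k:{1..n}. ?I (k - 1) (length s)). zterm x k * mhs_term s ks)"
    unfolding mhs_def eq by (subst sum.reindex) (auto simp: inj_on_def mhs_term_Cons intro!: sum.cong)
  also have "\<dots> = (\<Sum>k=1..n. zterm x k * mhs (k - 1) s)"
    by (subst sum.Sigma[symmetric]) (auto simp: mhs_def sum_distrib_left intro: finite_index[unfolded One_nat_def])
  finally show ?thesis .
qed

lemma mhs_star_Cons: "mhs_star n (x # s) = (\<Sum>k=1..n. zterm x k * mhs_star k s)"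
proof -
  let ?I = "\<lambda>n m. {ks. length ks = m \<and> set ks \<subseteq> {1..n::nat} \<and> sorted_wrt (\<ge>) ks}"
  have eq: "?I n (length (x # s)) = (\<lambda>(k, ks). k # ks) ` (SIGMA k:{1..n}. ?I k (length s))" (is "?L = ?R")
  proof (intro equalityI subsetI)
    fix ks assume ks: "ks \<in> ?L"
    then obtain k ks' where k: "ks = k # ks'" by (cases ks) auto
    with ks show "ks \<in> ?R" by (force simp: image_iff)
  next
    fix ks assume "ks \<in> ?R" then show "ks \<in> ?L" by fastforce
  qed
  have "mhs_star n (x # s) = (\<Sum>(k, ks)\<in>(SIGMA k:{1..n}. ?I k (length s)). zterm x k * mhs_term s ks)"
    unfolding mhs_star_def eq by (subst sum.reindex) (auto simp: inj_on_def mhs_term_Cons intro!: sum.cong)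
  also have "\<dots> = (\<Sum>k=1..n. zterm x k * mhs_star k s)"
    by (subst sum.Sigma[symmetric]) (auto simp: mhs_star_def sum_distrib_left intro: finite_index[unfolded One_nat_def])
  finally show ?thesis .
qed

section \<open>Weighted sums\<close>

text \<open>The product form of \<open>(n choose k) / (n + k choose k)\<close>.\<close>

primrec wt :: "nat \<Rightarrow> nat \<Rightarrow> real" where
  "wt n 0 = 1"
| "wt n (Suc k) = wt n k * (real n - real k) / (real n + real k + 1)"

lemma wt_eq_0: "n < k \<Longrightarrow> wt n k = 0"
  by (induction k) (auto simp: less_Suc_eq)

lemma wt_nonneg: "0 \<le> wt n k"
proof (induction k)
  case (Suc k)
  then show ?case by (cases "k \<le> n") (auto simp: wt_eq_0)
qed simp

lemma wt_le_1: "wt n k \<le> 1"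
proof (induction k)
  case (Suc k)
  show ?case
  proof (cases "k \<le> n")
    case True
    then have "(real n - real k) / (real n + real k + 1) \<le> 1" by simp
    then have "wt n k * ((real n - real k) / (real n + real k + 1)) \<le> 1"
      using Suc True by (intro mult_le_one) (auto simp: wt_nonneg)
    then show ?thesis by simp
  qed (simp add: wt_eq_0)
qed simp

lemma tendsto_wt: "(\<lambda>n. wt n k) \<longlonglongrightarrow> 1"
proof (induction k)
  case (Suc k)
  have "(\<lambda>n. 1 - (2 * real k + 1) * inverse (real n + (real k + 1))) \<longlonglongrightarrow> 1 - (2 * real k + 1) * 0"
    by (intro tendsto_intros tendsto_inverse_0_at_top filterlim_at_top_mono[OF filterlim_real_sequentially]) auto
  moreover have "1 - (2 * real k + 1) * inverse (real n + (real k + 1)) =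
      (real n - real k) / (real n + real k + 1)" for n
    by (simp add: field_simps)
  ultimately have "(\<lambda>n. (real n - real k) / (real n + real k + 1)) \<longlonglongrightarrow> 1" by simp
  from tendsto_mult[OF Suc this] show ?case by simp
qed simp

text \<open>In factorials \<open>wt n k\<close> is \<open>n!^2 / ((n - k)! * (n + k)!)\<close>,
  whose quotient for consecutive \<open>n\<close> is immediate. Denominators are cleared so that
  \<open>k = n + 1\<close> is covered, where both sides vanish.\<close>

lemma wt_Suc_left:
  "wt (Suc n) k * ((real n + 1)\<^sup>2 - (real k)\<^sup>2) = wt n k * (real n + 1)\<^sup>2"
proof (induction k)
  case (Suc k)
  have pos: "real n + real k + 2 \<noteq> 0" "real n + real k + 1 \<noteq> 0" by linarith+
  have "wt (Suc n) (Suc k) * ((real n + 1)\<^sup>2 - (real (Suc k))\<^sup>2)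
      = wt (Suc n) k * (real n + 1 - real k) * (real n - real k)"
    using pos by (simp add: divide_simps power2_eq_square) (simp add: algebra_simps)
  also have "\<dots> = (wt (Suc n) k * ((real n + 1)\<^sup>2 - (real k)\<^sup>2)) * (real n - real k) / (real n + real k + 1)"
    using pos by (simp add: divide_simps power2_eq_square) (simp add: algebra_simps)
  also have "\<dots> = wt n (Suc k) * (real n + 1)\<^sup>2"
    unfolding Suc by simp
  finally show ?case .
qed simp

definition wsum :: "nat \<Rightarrow> (nat \<Rightarrow> real) \<Rightarrow> real" where
  "wsum n A = (\<Sum>k=1..n. wt n k * A k)"

lemma wsum_cong: "(\<And>k. k \<ge> 1 \<Longrightarrow> A k = B k) \<Longrightarrow> wsum n A = wsum n B"
  by (simp add: wsum_def)

definition bsum :: "(nat \<Rightarrow> real) \<Rightarrow> nat \<Rightarrow> real" where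
  "bsum A k = A k + 2 * (\<Sum>l=1..<k. A l)"

lemma bsum_cong: "(\<And>k. k \<ge> 1 \<Longrightarrow> A k = B k) \<Longrightarrow> k \<ge> 1 \<Longrightarrow> bsum A k = bsum B k"
  by (simp add: bsum_def)

lemma bsum_cmult: "bsum (\<lambda>k. x * A k) k = x * bsum A k"
  by (simp add: bsum_def sum_distrib_left algebra_simps)

text \<open>Since \<open>wt n k = (2n choose n + k) / (2n choose n)\<close>, this is one half of the
  vanishing alternating sum of binomial coefficients with the central term removed. It supplies the
  expansion of the empty index.\<close>

lemma wsum_minus_one_power:
  assumes "n \<ge> 1" shows "wsum n (\<lambda>k. (-1) ^ k) = - 1 / 2"
proof -
  \<comment> \<open>A closed form for every truncation makes induction possible; at
    \<open>m = n\<close> the last term drops out because \<open>wt n (Suc n) = 0\<close>.\<close>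
  have "2 * real n * (\<Sum>k=1..m. wt n k * (-1) ^ k) = - real n - (-1) ^ Suc m * ((real n + real m + 1) * wt n (Suc m))" for m
  proof (induction m)
    case 0
    have "real n + 1 \<noteq> 0" by linarith
    then show ?case by simp
  next
    case (Suc m)
    have step: "(real n + real k + 1) * wt n (Suc k) = (real n - real k) * wt n k" for k
    proof -
      have "real n + real k + 1 \<noteq> 0" by linarith
      then show ?thesis by simp
    qed
    have "2 * real n * (\<Sum>k=1..Suc m. wt n k * (-1) ^ k) =
       - real n - (-1) ^ Suc m * ((real n + real m + 1) * wt n (Suc m)) + 2 * real n * (wt n (Suc m) * (-1) ^ Suc m)"
      using Suc by (simp add: algebra_simps del: wt.simps)
    also have "\<dots> = - real n - (-1) ^ Suc (Suc m) * ((real n - real (Suc m)) * wt n (Suc m))"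
      by (simp add: algebra_simps del: wt.simps)
    finally show ?case unfolding step .
  qed
  from this[of n] have "2 * real n * wsum n (\<lambda>k. (-1) ^ k) = - real n"
    by (simp add: wsum_def)
  then have "real n * (2 * wsum n (\<lambda>k. (-1) ^ k) + 1) = 0" by (simp add: algebra_simps)
  with assms show ?thesis by simp
qed

text \<open>Summation by parts, based on
  \<open>(n - k) * wt n k = (n + k + 1) * wt n (k + 1)\<close>. Truncating at \<open>N\<close>
  leaves a boundary term with the factor \<open>n - N\<close>, which is zero at
  \<open>N = n\<close>.\<close>

lemma wsum_mult: "real n * wsum n A = wsum n (\<lambda>k. real k * bsum A k)"
proof -
  have "real n * (\<Sum>k=1..N. wt n k * A k) =
      (\<Sum>k=1..N. wt n k * (real k * bsum A k)) + (real n - real N) * wt n N * (\<Sum>l=1..N. A l)" for N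
  proof (induction N)
    case (Suc N)
    have "real n + real N + 1 \<noteq> 0" by linarith
    then have step: "(real n - real N) * wt n N = (real n + real N + 1) * wt n (Suc N)" by simp
    have set: "sum A {1..<Suc N} = sum A {1..N}" by (simp add: atLeastLessThanSuc_atLeastAtMost)
    show ?case
      using Suc unfolding step by (simp add: bsum_def set[unfolded One_nat_def] algebra_simps del: wt.simps sum.op_ivl_Suc)
  qed simp
  from this[of n] show ?thesis by (simp add: wsum_def)
qed

lemma wsum_telescope:
  "(\<Sum>m=1..n. wsum m A / (real m)\<^sup>2) = wsum n (\<lambda>k. A k / (real k)\<^sup>2)"
proof (induction n)
  case 0
  show ?case by (simp add: wsum_def)
next
  case (Suc n)
  have "wt n k * (A k / (real k)\<^sup>2) + wt (Suc n) k * A k / (real (Suc n))\<^sup>2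
      = wt (Suc n) k * (A k / (real k)\<^sup>2)" if "k \<ge> 1" for k
  proof -
    have n: "(real n + 1)\<^sup>2 \<noteq> 0" by simp
    have wt: "wt n k = wt (Suc n) k * (1 - (real k)\<^sup>2 / (real n + 1)\<^sup>2)"
      using wt_Suc_left[of n k] n by (simp add: field_simps)
    have S: "real (Suc n) = real n + 1" by simp
    show ?thesis
      unfolding wt S using that by (simp add: algebra_simps)
  qed
  \<comment> \<open>The first sum may run to \<open>Suc n\<close> because
    \<open>wt n (Suc n) = 0\<close>.\<close>
  then have "(\<Sum>k=1..Suc n. wt n k * (A k / (real k)\<^sup>2)) + wsum (Suc n) A / (real (Suc n))\<^sup>2
      = wsum (Suc n) (\<lambda>k. A k / (real k)\<^sup>2)"
    unfolding wsum_def sum_divide_distrib sum.distrib[symmetric] by (intro sum.cong) auto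
  then show ?case using Suc by (simp add: wsum_def wt_eq_0 del: wt.simps)
qed

text \<open>On generating functions \<open>bsum\<close> multiplies by
  \<open>(1 + x) / (1 - x)\<close>. Conjugation by \<open>(-1)^k\<close> replaces \<open>x\<close>
  by \<open>-x\<close>, which gives the reciprocal factor.\<close>

lemma bsum_inverse:
  assumes "k \<ge> 1"
  shows "bsum (\<lambda>k. (-1) ^ k * bsum (\<lambda>l. (-1) ^ l * B l) k) k = B k"
proof -
  \<comment> \<open>If S_l denotes the partial sums of \<open>(-1)^l * B l\<close>, the inner
    \<open>bsum\<close> is S_l + S_(l-1), so the alternating sum telescopes.\<close>
  have "(\<Sum>l=1..<Suc k. (-1) ^ l * bsum (\<lambda>l. (-1) ^ l * B l) l) = (-1) ^ k * (\<Sum>l=1..<Suc k. (-1) ^ l * B l)" for k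
    by (induction k) (auto simp: bsum_def algebra_simps)
  from this[of "k - 1"] assms
  have "(\<Sum>l=1..<k. (-1) ^ l * bsum (\<lambda>l. (-1) ^ l * B l) l) = - ((-1) ^ k * (\<Sum>l=1..<k. (-1) ^ l * B l))"
    by (cases k) auto
  then show ?thesis
    by (subst bsum_def) (simp add: bsum_def algebra_simps)
qed

lemma wsum_divide:
  assumes "n \<ge> 1"
  shows "wsum n A / real n = wsum n (\<lambda>k. (-1) ^ k * bsum (\<lambda>l. (-1) ^ l * (A l / real l)) k)"
proof -
  have "real n * wsum n (\<lambda>k. (-1) ^ k * bsum (\<lambda>l. (-1) ^ l * (A l / real l)) k) = wsum n A"
    unfolding wsum_mult by (intro wsum_cong) (subst bsum_inverse, simp_all)
  with assms show ?thesis by (simp add: field_simps)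
qed

section \<open>Expansions of star sums\<close>

text \<open>The case \<open>n = 0\<close> is left out because the empty index has star sum 1 there,
  while the weighted sum is empty.\<close>

definition expansion :: "int list \<Rightarrow> (nat \<Rightarrow> real) \<Rightarrow> bool" where
  "expansion s A \<longleftrightarrow> (\<forall>n\<ge>1. mhs_star n s = wsum n A)"

lemma expansion_cong:
  "expansion s A \<Longrightarrow> (\<And>k. k \<ge> 1 \<Longrightarrow> A k = B k) \<Longrightarrow> expansion s B"
  unfolding expansion_def using wsum_cong[of A B] by simp

lemma expansion_Nil: "expansion [] (\<lambda>k. - 2 * (-1) ^ k)"
proof -
  have "wsum n (\<lambda>k. - 2 * (-1) ^ k) = - 2 * wsum n (\<lambda>k. (-1) ^ k)" for n
    unfolding wsum_def sum_distrib_left by (intro sum.cong) auto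
  then show ?thesis by (simp add: expansion_def wsum_minus_one_power)
qed

text \<open>By \<open>wsum_telescope\<close>, any new first entry reduces to the case of a 2 once
  its remaining power of \<open>n\<close> has been absorbed into \<open>A\<close>.\<close>

lemma expansion_Cons:
  assumes eq: "\<And>n. n \<ge> 1 \<Longrightarrow> zterm x n * mhs_star n s = wsum n A / (real n)\<^sup>2"
  shows "expansion (x # s) (\<lambda>k. A k / (real k)\<^sup>2)"
  unfolding expansion_def mhs_star_Cons wsum_telescope[symmetric]
  using eq by (auto intro!: sum.cong)

lemma expansion_2: "expansion s A \<Longrightarrow> expansion (2 # s) (\<lambda>k. A k / (real k)\<^sup>2)"
  by (rule expansion_Cons) (auto simp: expansion_def zterm_def)

lemma expansion_2s: "expansion s A \<Longrightarrow> expansion (replicate m 2 @ s) (\<lambda>k. A k / real k ^ (2 * m))"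
proof (induction m)
  case (Suc m)
  from expansion_2[OF Suc.IH[OF Suc.prems]] show ?case
    by (auto elim!: expansion_cong simp: power2_eq_square mult_ac)
qed simp

text \<open>Writing \<open>1 / n\<close> as \<open>n / n^2\<close> turns the entry 1 into a
  multiplication by \<open>n\<close> followed by the entry 2.\<close>

lemma expansion_1: "expansion s A \<Longrightarrow> expansion (1 # s) (\<lambda>k. bsum A k / real k)"
proof -
  assume "expansion s A"
  then have "expansion (1 # s) (\<lambda>k. real k * bsum A k / (real k)\<^sup>2)"
    by (intro expansion_Cons)
       (auto simp: expansion_def zterm_def wsum_mult[symmetric] field_simps power2_eq_square)
  then show ?thesis by (rule expansion_cong) (simp add: power2_eq_square)
qed

text \<open>A nested sum over weakly decreasing variables whose largest is fixed at
  \<open>k\<close>, each strict inequality carrying weight 2 and each equality weight 1.\<close>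

fun chain :: "int list \<Rightarrow> nat \<Rightarrow> real" where
  "chain [] k = 0"
| "chain [x] k = zterm x k"
| "chain (x # y # ys) k = zterm x k * bsum (chain (y # ys)) k"

lemma chain_Cons: "v \<noteq> [] \<Longrightarrow> chain (x # v) k = zterm x k * bsum (chain v) k"
  by (cases v) auto

text \<open>Expansions alternate between two normal forms: this one for the final run of 2s and
  after a block \<open>{2}^a, 1\<close>, and \<open>- 2 * chain v k\<close> after a block
  \<open>{2}^b, c\<close>.\<close>

definition twisted_chain :: "int list \<Rightarrow> nat \<Rightarrow> real" where
  "twisted_chain v k = - 2 * (-1) ^ k * real k * chain v k"

lemma twisted_chain_2s: "expansion (replicate t 2) (twisted_chain [2 * int t + 1])"
  using expansion_2s[OF expansion_Nil, of t]
  by (auto elim!: expansion_cong simp: twisted_chain_def zterm_def nat_add_distrib nat_mult_distrib)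

text \<open>The first division by \<open>n\<close> cancels the factor \<open>k\<close> of the
  twisted form and leaves one \<open>bsum\<close>; the sign survives outside. Each further division
  puts an entry 1 in front of the chain.\<close>

lemma divided_expansion:
  assumes s: "expansion s (twisted_chain v)" and v: "v \<noteq> []" and n: "n \<ge> 1"
  shows "mhs_star n s / real n ^ Suc m =
    wsum n (\<lambda>k. - 2 * (-1) ^ k * bsum (chain (replicate m 1 @ v)) k)"
proof (induction m)
  case 0
  have "mhs_star n s / real n = wsum n (twisted_chain v) / real n"
    using s n by (simp add: expansion_def)
  also have "\<dots> = wsum n (\<lambda>k. - 2 * (-1) ^ k * bsum (chain v) k)"
  proof (subst wsum_divide[OF n], rule wsum_cong)
    fix k :: nat assume "k \<ge> 1"
    then have "bsum (\<lambda>l. (-1) ^ l * (twisted_chain v l / real l)) k = bsum (\<lambda>l. - 2 * chain v l) k"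
      by (intro bsum_cong) (auto simp: twisted_chain_def)
    then show "(-1) ^ k * bsum (\<lambda>l. (-1) ^ l * (twisted_chain v l / real l)) k = - 2 * (-1) ^ k * bsum (chain v) k"
      by (simp only: bsum_cmult)
  qed
  finally show ?case by simp
next
  case (Suc m)
  let ?w = "replicate m 1 @ v"
  have "mhs_star n s / real n ^ Suc (Suc m) = (mhs_star n s / real n ^ Suc m) / real n" by simp
  also have "\<dots> = wsum n (\<lambda>k. - 2 * (-1) ^ k * bsum (chain ?w) k) / real n" unfolding Suc ..
  also have "\<dots> = wsum n (\<lambda>k. - 2 * (-1) ^ k * bsum (chain (1 # ?w)) k)"
  proof (subst wsum_divide[OF n], rule wsum_cong)
    fix k :: nat assume "k \<ge> 1"
    then have "bsum (\<lambda>l. (-1) ^ l * (- 2 * (-1) ^ l * bsum (chain ?w) l / real l)) k = bsum (\<lambda>l. - 2 * chain (1 # ?w) l) k"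
      using v by (intro bsum_cong) (auto simp: chain_Cons zterm_def)
    then show "(-1) ^ k * bsum (\<lambda>l. (-1) ^ l * (- 2 * (-1) ^ l * bsum (chain ?w) l / real l)) k
       = - 2 * (-1) ^ k * bsum (chain (1 # ?w)) k"
      by (simp only: bsum_cmult)
  qed
  finally show ?case by simp
qed

text \<open>The exponent splits as \<open>c = 2 + 1 + (c - 3)\<close>: two powers go into the
  telescoping sum, one undoes the twist, and the others become entries 1. The surviving sign and the
  \<open>2b + 2\<close> powers of \<open>k\<close> form the barred entry.\<close>

lemma chain_2s_Cons:
  assumes s: "expansion s (twisted_chain v)" and v: "v \<noteq> []" and c: "c \<ge> 3"
  shows "expansion (replicate b 2 @ [c] @ s)
    (\<lambda>k. - 2 * chain ([- (2 * int b + 2)] @ replicate (nat (c - 3)) 1 @ v) k)"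
proof -
  let ?w = "replicate (nat (c - 3)) 1 @ v"
  have "expansion (c # s) (\<lambda>k. - 2 * (-1) ^ k * bsum (chain ?w) k / (real k)\<^sup>2)"
  proof (rule expansion_Cons)
    fix n :: nat assume n: "n \<ge> 1"
    have "nat \<bar>c\<bar> = Suc (nat (c - 3)) + 2" using c by simp
    then have "zterm c n = 1 / (real n ^ Suc (nat (c - 3)) * (real n)\<^sup>2)"
      using c by (simp only: zterm_def power_add) simp
    then have "zterm c n * mhs_star n s = (mhs_star n s / real n ^ Suc (nat (c - 3))) / (real n)\<^sup>2"
      by simp
    then show "zterm c n * mhs_star n s = wsum n (\<lambda>k. - 2 * (-1) ^ k * bsum (chain ?w) k) / (real n)\<^sup>2"
      unfolding divided_expansion[OF s v n] .
  qed
  from expansion_2s[OF this, of b] show ?thesis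
    using v by (auto elim!: expansion_cong
        simp: chain_Cons zterm_def nat_add_distrib nat_mult_distrib power_add power2_eq_square)
qed

lemma expansion_2s_1:
  assumes "expansion s (\<lambda>k. - 2 * chain v k)"
  shows "expansion (replicate a 2 @ [1] @ s) (\<lambda>k. - 2 * bsum (chain v) k / real k ^ (2 * a + 1))"
  using expansion_2s[OF expansion_1[OF assms], of a]
  by (auto elim!: expansion_cong simp: bsum_cmult[of "- 2", simplified])

text \<open>Inserting \<open>(-1)^k * (-1)^k\<close> and \<open>k / k\<close> exhibits the twisted
  form: one sign and the factor \<open>k\<close> stay outside, so the entry is barred and its size
  rises to \<open>2a + 2\<close>.\<close>

lemma twisted_chain_2s_1:
  assumes "expansion s (\<lambda>k. - 2 * chain v k)" and v: "v \<noteq> []"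
  shows "expansion (replicate a 2 @ [1] @ s) (twisted_chain ((- (2 * int a + 2)) # v))"
proof (rule expansion_cong[OF expansion_2s_1[OF assms(1), of a]])
  fix k :: nat assume "k \<ge> 1"
  moreover have "nat \<bar>- (2 * int a + 2)\<bar> = Suc (2 * a + 1)" by simp
  ultimately show "- 2 * bsum (chain v) k / real k ^ (2 * a + 1) = twisted_chain ((- (2 * int a + 2)) # v) k"
    using v by (simp add: twisted_chain_def chain_Cons zterm_def del: abs_minus_cancel)
qed

text \<open>The same expansion read without a twist; it serves an outermost block, where the limit
  requires the plain form.\<close>

lemma chain_2s_1:
  assumes "expansion s (\<lambda>k. - 2 * chain v k)" and v: "v \<noteq> []"
  shows "expansion (replicate a 2 @ [1] @ s) (\<lambda>k. - 2 * chain ((2 * int a + 1) # v) k)"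
proof (rule expansion_cong[OF expansion_2s_1[OF assms(1), of a]])
  fix k :: nat assume "k \<ge> 1"
  moreover have "nat \<bar>2 * int a + 1\<bar> = 2 * a + 1" by simp
  ultimately show "- 2 * bsum (chain v) k / real k ^ (2 * a + 1) = - 2 * chain ((2 * int a + 1) # v) k"
    using v by (simp add: chain_Cons zterm_def)
qed

section \<open>Merged indices\<close>

lemma merge_nonzero:
  assumes "x \<noteq> 0" "y \<noteq> 0"
  shows "sgn (x \<oplus> y) = sgn x * sgn y" "\<bar>x \<oplus> y\<bar> = \<bar>x\<bar> + \<bar>y\<bar>"
  using assms by (cases "x > 0"; cases "y > 0"; simp add: merge_def)+

lemma zterm_merge: "x \<noteq> 0 \<Longrightarrow> y \<noteq> 0 \<Longrightarrow> zterm (x \<oplus> y) k = zterm x k * zterm y k"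
  by (simp add: zterm_def merge_nonzero nat_add_distrib power_add power_mult_distrib)

lemma finite_merges: "finite (merges u)"
  by (induction u rule: merges.induct) auto

text \<open>Merging adds absolute values, so a head never shrinks. This separates the two branches
  of \<open>merges\<close> and passes the convergence condition from \<open>u\<close> to every
  \<open>p\<close>.\<close>

lemma merges_nonzero:
  "p \<in> merges u \<Longrightarrow> 0 \<notin> set u \<Longrightarrow> p \<noteq> [] \<and> 0 \<notin> set p \<and> \<bar>hd p\<bar> \<ge> \<bar>hd u\<bar>"
proof (induction u arbitrary: p rule: merges.induct)
  case (3 s u us)
  have su: "s \<oplus> u \<noteq> 0" "\<bar>s \<oplus> u\<bar> \<ge> \<bar>s\<bar>"
    using "3.prems" merge_nonzero(2)[of s u] by auto
  show ?case
  proof (cases "p \<in> merges ((s \<oplus> u) # us)")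
    case True
    from "3.IH"(2)[OF this] "3.prems" su show ?thesis by auto
  next
    case False
    with "3.prems" obtain q where q: "p = s # q" "q \<in> merges (u # us)" by auto
    from "3.IH"(1)[OF q(2)] "3.prems" q(1) show ?thesis by auto
  qed
qed auto

text \<open>The part of \<open>mhs n p\<close> in which the largest summation variable equals \<open>k\<close>.\<close>

definition lead :: "int list \<Rightarrow> nat \<Rightarrow> real" where
  "lead p k = zterm (hd p) k * mhs (k - 1) (tl p)"

lemma mhs_eq_lead: "p \<noteq> [] \<Longrightarrow> mhs n p = (\<Sum>k=1..n. lead p k)"
  by (cases p) (auto simp: mhs_Cons lead_def)

text \<open>A comma corresponds to a strict inequality and contributes the factor 2 of
  \<open>bsum\<close>; a merge corresponds to its diagonal term. The extra 2 on the right accounts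
  for the first component.\<close>

lemma sum_merges:
  "0 \<notin> set u \<Longrightarrow> (\<Sum>p\<in>merges u. 2 ^ length p * lead p k) = 2 * chain u k"
proof (induction u arbitrary: k rule: merges.induct)
  case (3 s u us)
  have nz: "s \<noteq> 0" "u \<noteq> 0" "s \<oplus> u \<noteq> 0" "\<bar>s \<oplus> u\<bar> > \<bar>s\<bar>"
    using "3.prems" merge_nonzero(2)[of s u] by auto
  then have nz': "0 \<notin> set (u # us)" "0 \<notin> set ((s \<oplus> u) # us)" using "3.prems" by auto
  let ?M = "merges (u # us)" and ?N = "merges ((s \<oplus> u) # us)"
  \<comment> \<open>Heads are \<open>s\<close> on the left and at least
    \<open>\<bar>s \<oplus> u\<bar> > \<bar>s\<bar>\<close> in size on the right, so no index is
    produced twice.\<close>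
  have disj: "(#) s ` ?M \<inter> ?N = {}"
    using merges_nonzero[OF _ nz'(2)] nz(4) by fastforce
  have "(\<Sum>p\<in>(#) s ` ?M. 2 ^ length p * lead p k) =
      (\<Sum>q\<in>?M. 2 ^ Suc (length q) * (zterm s k * mhs (k - 1) q))"
    by (subst sum.reindex) (auto simp: lead_def)
  also have "\<dots> = (\<Sum>q\<in>?M. \<Sum>l=1..<k. 2 * zterm s k * (2 ^ length q * lead q l))"
  proof (rule sum.cong)
    fix q assume "q \<in> ?M"
    then have "mhs (k - 1) q = (\<Sum>l=1..k - 1. lead q l)"
      using mhs_eq_lead merges_nonzero[OF _ nz'(1)] by blast
    moreover have "{1..k - 1} = {1..<k}" by auto
    ultimately show "2 ^ Suc (length q) * (zterm s k * mhs (k - 1) q) =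
        (\<Sum>l=1..<k. 2 * zterm s k * (2 ^ length q * lead q l))"
      by (simp add: sum_distrib_left mult_ac)
  qed simp
  also have "\<dots> = (\<Sum>l=1..<k. 2 * zterm s k * (\<Sum>q\<in>?M. 2 ^ length q * lead q l))"
    by (subst sum.swap) (simp add: sum_distrib_left)
  also have "\<dots> = (\<Sum>l=1..<k. 2 * zterm s k * (2 * chain (u # us) l))"
    using "3.IH"(1)[OF nz'(1)] by simp
  finally have 1: "(\<Sum>p\<in>(#) s ` ?M. 2 ^ length p * lead p k) =
      2 * zterm s k * (2 * (\<Sum>l=1..<k. chain (u # us) l))"
    by (simp add: sum_distrib_left mult_ac)
  have "chain ((s \<oplus> u) # us) k = zterm s k * chain (u # us) k"
    using nz by (cases us) (auto simp: zterm_merge)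
  with "3.IH"(2)[OF nz'(2)]
  have 2: "(\<Sum>p\<in>?N. 2 ^ length p * lead p k) = 2 * zterm s k * chain (u # us) k" by simp
  have "(\<Sum>p\<in>merges (s # u # us). 2 ^ length p * lead p k)
      = 2 * zterm s k * (2 * (\<Sum>l=1..<k. chain (u # us) l)) + 2 * zterm s k * chain (u # us) k"
    unfolding merges.simps 1[symmetric] 2[symmetric]
    by (rule sum.union_disjoint[OF _ _ disj]) (auto simp: finite_merges)
  then show ?case by (simp add: bsum_def algebra_simps)
qed (auto simp: lead_def)

section \<open>Passage to the limit\<close>

lemma sum_inverse_sqrt_le: "(\<Sum>k=1..n. 1 / sqrt (real k)) \<le> 2 * sqrt (real n)"
proof (induction n)
  case (Suc n)
  define x y where "x = sqrt (real n)" and "y = sqrt (real (Suc n))"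
  have xy: "x \<ge> 0" "y > 0" "y\<^sup>2 = x\<^sup>2 + 1" by (auto simp: x_def y_def)
  \<comment> \<open>As \<open>y^2 - x^2 = 1\<close>, the square equals
    \<open>2 * y * (y - x) - 1\<close>.\<close>
  have "0 \<le> (y - x)\<^sup>2" by simp
  then have "1 \<le> 2 * y * (y - x)" using xy by (simp add: power2_eq_square algebra_simps)
  then have "1 / y \<le> 2 * (y - x)" using xy by (simp add: field_simps)
  with Suc show ?case by (simp add: x_def y_def)
qed simp

lemma zterm_bound:
  assumes "int m \<le> \<bar>x\<bar>" "k \<ge> 1" shows "\<bar>zterm x k\<bar> \<le> 1 / real k ^ m"
proof -
  have "real k ^ m \<le> real k ^ nat \<bar>x\<bar>" using assms by (intro power_increasing) auto
  then have "1 / real k ^ nat \<bar>x\<bar> \<le> 1 / real k ^ m" using assms by (intro divide_left_mono) auto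
  moreover have "\<bar>real_of_int (sgn x) ^ k\<bar> \<le> 1"
    by (cases "x = 0") (auto simp: power_abs sgn_if power_le_one)
  then have "\<bar>zterm x k\<bar> \<le> 1 / real k ^ nat \<bar>x\<bar>"
    by (auto simp: zterm_def abs_divide intro: divide_right_mono)
  ultimately show ?thesis by linarith
qed

text \<open>The growth is polylogarithmic; any bound by a power of \<open>n\<close> below the first suffices for Tannery's theorem.\<close>

lemma mhs_bound:
  "0 \<notin> set q \<Longrightarrow> \<exists>C\<ge>0. \<forall>n. \<bar>mhs n q\<bar> \<le> C * sqrt (real n + 1)"
proof (induction q)
  case Nil
  show ?case by (intro exI[of _ 1]) auto
next
  case (Cons x q)
  then obtain C where C: "C \<ge> 0" "\<And>n. \<bar>mhs n q\<bar> \<le> C * sqrt (real n + 1)" by auto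
  have "\<bar>mhs n (x # q)\<bar> \<le> 2 * C * sqrt (real n + 1)" for n
  proof -
    have "\<bar>mhs n (x # q)\<bar> \<le> (\<Sum>k=1..n. C * (1 / sqrt (real k)))"
      unfolding mhs_Cons
    proof (rule sum_abs[THEN order_trans], rule sum_mono)
      fix k assume k: "k \<in> {1..n}"
      then have "\<bar>zterm x k\<bar> \<le> 1 / real k"
        using zterm_bound[of 1 x k] Cons.prems by auto
      moreover have "\<bar>mhs (k - 1) q\<bar> \<le> C * sqrt (real k)"
        using C(2)[of "k - 1"] k by simp
      ultimately have "\<bar>zterm x k * mhs (k - 1) q\<bar> \<le> 1 / real k * (C * sqrt (real k))"
        unfolding abs_mult by (intro mult_mono) auto
      also have "\<dots> = C * (1 / sqrt (real k))"
        using k by (simp add: field_simps)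
      finally show "\<bar>zterm x k * mhs (k - 1) q\<bar> \<le> C * (1 / sqrt (real k))" .
    qed
    also have "\<dots> \<le> C * (2 * sqrt (real n))"
      unfolding sum_distrib_left[symmetric] using C(1) sum_inverse_sqrt_le by (intro mult_left_mono)
    also have "\<dots> \<le> C * (2 * sqrt (real n + 1))"
      using C(1) by (intro mult_left_mono) auto
    finally show ?thesis by simp
  qed
  then show ?case using C(1) by (intro exI[of _ "2 * C"]) auto
qed

text \<open>The head gives \<open>k^(-2)\<close> and the tail at most a multiple of
  \<open>k^(1/2)\<close>, which leaves a summable majorant independent of \<open>n\<close>.\<close>

lemma lead_bound:
  assumes "p \<noteq> []" "0 \<notin> set p" "\<bar>hd p\<bar> \<ge> 2"
  shows "\<exists>C. \<forall>k\<ge>1. \<bar>lead p k\<bar> \<le> C * real k powr (- 3 / 2)"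
proof -
  from assms have "0 \<notin> set (tl p)" by (cases p) auto
  from mhs_bound[OF this] obtain C where C: "C \<ge> 0" "\<And>n. \<bar>mhs n (tl p)\<bar> \<le> C * sqrt (real n + 1)" by auto
  have "\<bar>lead p k\<bar> \<le> C * real k powr (- 3 / 2)" if k: "k \<ge> 1" for k
  proof -
    have "\<bar>zterm (hd p) k\<bar> \<le> 1 / (real k)\<^sup>2"
      using zterm_bound[of 2 "hd p" k] assms k by auto
    moreover have "\<bar>mhs (k - 1) (tl p)\<bar> \<le> C * sqrt (real k)"
      using C(2)[of "k - 1"] k by simp
    ultimately have "\<bar>lead p k\<bar> \<le> 1 / (real k)\<^sup>2 * (C * sqrt (real k))"
      unfolding abs_mult lead_def by (intro mult_mono) auto
    also have "\<dots> = C * (real k powr (- 2) * real k powr (1 / 2))"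
      using k by (simp add: powr_minus powr_half_sqrt field_simps)
    also have "\<dots> = C * real k powr (- 3 / 2)"
      unfolding powr_add[symmetric] by simp
    finally show ?thesis .
  qed
  then show ?thesis by blast
qed

lemma wsum_lead_tendsto_mzv:
  assumes "p \<noteq> []" "0 \<notin> set p" "\<bar>hd p\<bar> \<ge> 2"
  shows "(\<lambda>n. wsum n (lead p)) \<longlonglongrightarrow> mzv p"
proof -
  define f where "f k = (if k \<ge> 1 then lead p k else 0)" for k
  obtain C where C: "\<And>k. k \<ge> 1 \<Longrightarrow> \<bar>lead p k\<bar> \<le> C * real k powr (- 3 / 2)"
    using lead_bound[OF assms] by blast
  define M where "M k = C * real k powr (- 3 / 2)" for k
  have M: "summable M"
    unfolding M_def by (intro summable_mult) (simp add: summable_real_powr_iff)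
  have f: "\<bar>f k\<bar> \<le> M k" for k using C[of k] by (cases k) (auto simp: f_def M_def)
  have bound: "\<bar>wt n k * f k\<bar> \<le> M k" for n k
  proof -
    have "\<bar>wt n k\<bar> * \<bar>f k\<bar> \<le> 1 * \<bar>f k\<bar>"
      using wt_nonneg[of n k] wt_le_1[of n k] by (intro mult_right_mono) auto
    then show ?thesis using f[of k] by (simp add: abs_mult)
  qed
  have "(\<lambda>n. suminf (\<lambda>k. wt n k * f k)) \<longlonglongrightarrow> suminf f"
    by (rule tannerys_theorem[THEN conjunct2, THEN conjunct2, OF _ _ M])
       (use bound in \<open>auto intro!: tendsto_eq_intros tendsto_wt always_eventually\<close>)
  \<comment> \<open>The weights vanish for \<open>k > n\<close>, so the series is really a finite
    sum.\<close>
  moreover have "suminf (\<lambda>k. wt n k * f k) = wsum n (lead p)" for n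
  proof -
    have "suminf (\<lambda>k. wt n k * f k) = (\<Sum>k\<in>{1..n}. wt n k * f k)"
      by (rule suminf_finite) (auto simp: f_def wt_eq_0 not_le)
    then show ?thesis by (simp add: wsum_def f_def)
  qed
  moreover have "mzv p = suminf f"
  proof -
    have "summable f" using f by (intro summable_comparison_test[OF _ M]) auto
    then have "(\<lambda>n. \<Sum>k\<le>n. f k) \<longlonglongrightarrow> suminf f" by (rule summable_LIMSEQ')
    moreover have "(\<Sum>k\<le>n. f k) = mhs n p" for n
      unfolding mhs_eq_lead[OF assms(1)] f_def
      by (subst sum.inter_filter[symmetric]) (auto intro!: sum.cong)
    ultimately show ?thesis unfolding mzv_def by (simp add: limI)
  qed
  ultimately show ?thesis by simp
qed

text \<open>The identity is exact for each \<open>n \<ge> 1\<close> in terms of weighted sums; only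
  then does \<open>n\<close> tend to infinity, separately for each of the finitely many
  \<open>p\<close>.\<close>

lemma mzv_star_eq:
  assumes s: "expansion s (\<lambda>k. - 2 * chain u k)" and u: "0 \<notin> set u" "\<bar>hd u\<bar> \<ge> 2"
  shows "mzv_star s = - (\<Sum>p\<in>merges u. 2 ^ length p * mzv p)"
proof -
  have "mhs_star n s = - (\<Sum>p\<in>merges u. 2 ^ length p * wsum n (lead p))" if "n \<ge> 1" for n
  proof -
    have "mhs_star n s = - (\<Sum>k=1..n. wt n k * (2 * chain u k))"
      using s that by (simp add: expansion_def wsum_def sum_negf)
    also have "\<dots> = - (\<Sum>k=1..n. \<Sum>p\<in>merges u. 2 ^ length p * (wt n k * lead p k))"
      unfolding sum_merges[OF u(1), symmetric] by (simp add: sum_distrib_left mult_ac)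
    finally show ?thesis
      by (subst (asm) sum.swap) (simp add: wsum_def sum_distrib_left)
  qed
  moreover have "(\<lambda>n. - (\<Sum>p\<in>merges u. 2 ^ length p * wsum n (lead p)))
      \<longlonglongrightarrow> - (\<Sum>p\<in>merges u. 2 ^ length p * mzv p)"
    using merges_nonzero[OF _ u(1)] u(2)
    by (intro tendsto_intros wsum_lead_tendsto_mzv) fastforce+
  ultimately have "(\<lambda>n. mhs_star n s) \<longlonglongrightarrow> - (\<Sum>p\<in>merges u. 2 ^ length p * mzv p)"
    by (subst tendsto_cong[OF eventually_sequentiallyI[of 1]]) auto
  then show ?thesis unfolding mzv_star_def by (rule limI)
qed

section \<open>The two families\<close>

text \<open>Blocks are added from the right: \<open>{2}^b, c\<close> passes from twisted to plain
  form, \<open>{2}^a, 1\<close> back to twisted.\<close>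

lemma twisted_chain_blocks:
  fixes a b :: "nat \<Rightarrow> nat" and c :: "nat \<Rightarrow> int"
  assumes "\<And>j. j \<in> set js \<Longrightarrow> c j \<ge> 3" and "expansion s (twisted_chain v)" "v \<noteq> []"
  shows "expansion (concat (map (\<lambda>j. replicate (a j) 2 @ [1] @ replicate (b j) 2 @ [c j]) js) @ s)
    (twisted_chain (concat (map (\<lambda>j. [- (2 * int (a j) + 2), - (2 * int (b j) + 2)]
                                   @ replicate (nat (c j - 3)) 1) js) @ v))"
  using assms(1)
proof (induction js)
  case (Cons j js)
  from twisted_chain_2s_1[OF chain_2s_Cons[OF Cons.IH], of "c j" "b j" "a j"] Cons.prems assms(3)
  show ?case by simp
qed (use assms in simp)

lemma chain_blocks:
  fixes a b :: "nat \<Rightarrow> nat" and c :: "nat \<Rightarrow> int"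
  assumes "\<And>j. j \<in> set js \<Longrightarrow> c j \<ge> 3" and "expansion s (\<lambda>k. - 2 * chain v k)" "v \<noteq> []"
  shows "expansion (concat (map (\<lambda>j. replicate (b j) 2 @ [c j] @ replicate (a j) 2 @ [1]) js) @ s)
    (\<lambda>k. - 2 * chain (concat (map (\<lambda>j. [- (2 * int (b j) + 2)] @ replicate (nat (c j - 3)) 1
                                 @ [- (2 * int (a j) + 2)]) js) @ v) k)"
  using assms(1)
proof (induction js)
  case (Cons j js)
  from chain_2s_Cons[OF twisted_chain_2s_1[OF Cons.IH], of "a j" "c j" "b j"] Cons.prems assms(3)
  show ?case by simp
qed (use assms in simp)

theorem theorem7p2:
  fixes r t :: nat and a b :: "nat \<Rightarrow> nat" and c :: "nat \<Rightarrow> int"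
  assumes "r \<ge> 1" and "\<forall>j\<ge>1. c j \<ge> 3"
  shows
    "(a 1 \<ge> 1 \<longrightarrow>
       mzv_star
         (concat (map (\<lambda>j. replicate (a j) 2 @ [1] @ replicate (b j) 2 @ [c j]) [1..<r+1])
          @ replicate t 2)
       = - (\<Sum>p\<in>merges
             ([2 * int (a 1) + 1, - (2 * int (b 1) + 2)] @ replicate (nat (c 1 - 3)) 1
              @ concat (map (\<lambda>j. [- (2 * int (a j) + 2), - (2 * int (b j) + 2)]
                                   @ replicate (nat (c j - 3)) 1) [2..<r+1])
              @ [2 * int t + 1]).
           2 ^ length p * mzv p))
     \<and>
     mzv_star
       (concat (map (\<lambda>j. replicate (b j) 2 @ [c j] @ replicate (a j) 2 @ [1]) [1..<r+1])
        @ replicate (b (r+1)) 2 @ [c (r+1)] @ replicate t 2)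
     = - (\<Sum>p\<in>merges
           (concat (map (\<lambda>j. [- (2 * int (b j) + 2)] @ replicate (nat (c j - 3)) 1
                                 @ [- (2 * int (a j) + 2)]) [1..<r+1])
            @ [- (2 * int (b (r+1)) + 2)] @ replicate (nat (c (r+1) - 3)) 1
            @ [2 * int t + 1]).
         2 ^ length p * mzv p)"
proof (intro conjI impI)
  have c: "c j \<ge> 3" if "j \<ge> 1" for j using assms(2) that by blast
  let ?ab = "\<lambda>js. concat (map (\<lambda>j. [- (2 * int (a j) + 2), - (2 * int (b j) + 2)]
      @ replicate (nat (c j - 3)) 1) js) @ [2 * int t + 1]"
  let ?S = "\<lambda>js. concat (map (\<lambda>j. replicate (a j) 2 @ [1] @ replicate (b j) 2 @ [c j]) js) @ replicate t 2"
  assume "a 1 \<ge> 1"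
  have "expansion (?S [2..<r+1]) (twisted_chain (?ab [2..<r+1]))"
    by (rule twisted_chain_blocks[OF _ twisted_chain_2s]) (auto intro: c)
  \<comment> \<open>The outermost block ends in plain form, whence the unbarred entry
    \<open>2 * a 1 + 1\<close> in place of a barred \<open>2 * a 1 + 2\<close>.\<close>
  from chain_2s_1[OF chain_2s_Cons[OF this _ c[of 1]], of "b 1" "a 1"]
  have "expansion (?S (1 # [2..<r+1])) (\<lambda>k. - 2 * chain ([2 * int (a 1) + 1, - (2 * int (b 1) + 2)]
      @ replicate (nat (c 1 - 3)) 1 @ ?ab [2..<r+1]) k)"
    by simp
  moreover have "[1..<r+1] = 1 # [2..<r+1]"
    using assms(1) by (simp add: upt_rec numeral_2_eq_2 del: upt_Suc)
  \<comment> \<open>Here \<open>a 1 \<ge> 1\<close> makes the leading entry at least 3, as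
    convergence demands.\<close>
  ultimately show "mzv_star (?S [1..<r+1]) = - (\<Sum>p\<in>merges ([2 * int (a 1) + 1, - (2 * int (b 1) + 2)]
      @ replicate (nat (c 1 - 3)) 1 @ ?ab [2..<r+1]). 2 ^ length p * mzv p)"
    using \<open>a 1 \<ge> 1\<close> by (intro mzv_star_eq) (auto simp del: upt_Suc)
next
  have c: "c j \<ge> 3" if "j \<ge> 1" for j using assms(2) that by blast
  let ?u = "concat (map (\<lambda>j. [- (2 * int (b j) + 2)] @ replicate (nat (c j - 3)) 1
      @ [- (2 * int (a j) + 2)]) [1..<r+1])
      @ [- (2 * int (b (r+1)) + 2)] @ replicate (nat (c (r+1) - 3)) 1 @ [2 * int t + 1]"
  have exp: "expansion (concat (map (\<lambda>j. replicate (b j) 2 @ [c j] @ replicate (a j) 2 @ [1]) [1..<r+1])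
      @ replicate (b (r+1)) 2 @ [c (r+1)] @ replicate t 2) (\<lambda>k. - 2 * chain ?u k)"
    \<comment> \<open>The tail \<open>{2}^b, c, {2}^t\<close> with index \<open>r + 1\<close>
      already has plain form and starts the induction over the blocks.\<close>
    by (rule chain_blocks[OF _ chain_2s_Cons[OF twisted_chain_2s]]) (auto intro: c)
  have "\<bar>hd ?u\<bar> \<ge> 2"
    using assms(1) by (simp add: upt_conv_Cons del: upt_Suc)
  then show "mzv_star (concat (map (\<lambda>j. replicate (b j) 2 @ [c j] @ replicate (a j) 2 @ [1]) [1..<r+1])
      @ replicate (b (r+1)) 2 @ [c (r+1)] @ replicate t 2) = - (\<Sum>p\<in>merges ?u. 2 ^ length p * mzv p)"
    by (intro mzv_star_eq[OF exp]) (auto simp del: upt_Suc)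
qed

end
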